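(* Let $m\ge3$ and $n\ge1$ be integers. Let $Q(u):=u^m-i^m$, $W(u,v,w):=iu^2v^2+u^2v+uv^2-2wuv+u+v-i$ with $i=\sqrt{-1}$, and $$D(w)=\frac{1}{2^{m^2}w^{3m-2}}\operatorname{Res}_u\Big(Q(u),\ \operatorname{Res}_v\big(Q(v),\,W(u,v,w)\big)\Big).$$ Let $E(w)\in\mathbb Q[w]$ be the polynomial with $D=E^3$ if $3\nmid m$ and $D=(w^2-\tfrac{27}4)E^3$ if $3\mid m$, let $\widehat E(x):=E(w)|_{w^2=x}$, and let $E^\vee(y):=y^{\deg\widehat E}\,\widehat E(1/y)$. Let $\mathcal E^\vee$ be the set of distinct roots of $E^\vee$, each root $\alpha$ having multiplicity $\mu(\alpha)$, and set $p_n:=\sum_{\alpha\in\mathcal E^\vee}\mu(\alpha)\alpha^n$. Then $$V_n(m)=\mathbf 1_{3\mid m}\cdot2\Big(\frac m3\Big)^{2n}+6\cdot3^n\Big(\frac m2\Big)^{2n}p_n.$$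
   Context: For integers $n\ge1$, $m\ge3$, the $\mathrm{SU}(3)$ Verlinde sum is $$V_n(m)=3^nm^{2n}\sum_{\substack{(j,\ell,k)\in(\mathbb Z/m\mathbb Z\setminus\{0\})^3\\ j+\ell+k\equiv 0 \bmod m}}\Big(8\sin\frac{\pi j}{m}\sin\frac{\pi\ell}{m}\sin\frac{\pi k}{m}\Big)^{-2n}.$$ $\operatorname{Res}_x$ is the resultant (Sylvester determinant) with respect to $x$. The polynomial $E$ exists for all $m\ge3$ and is even, so $\widehat E$ is the polynomial with $\widehat E(w^2)=E(w)$. $\mathbf 1_{3\mid m}$ equals $1$ if $3\mid m$ and $0$ otherwise. *)

theory Defs
  imports
    Complex_Main
    "HOL-Computational_Algebra.Computational_Algebra"
    "Subresultants.Resultant_Prelim"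
begin

text \<open>Nonzero classes modulo \<open>m\<close> are represented by \<open>1, \<dots>, m - 1\<close>. The choice of
  representatives is immaterial: the exponent is even, and no sine vanishes.\<close>

definition verlinde_sum :: "nat \<Rightarrow> nat \<Rightarrow> real" where
  "verlinde_sum n m = 3 ^ n * real m ^ (2 * n) *
     (\<Sum>(j, l, k) \<in> {(j, l, k). j \<in> {1..<m} \<and> l \<in> {1..<m} \<and> k \<in> {1..<m} \<and> m dvd j + l + k}.
        (8 * sin (pi * real j / real m) * sin (pi * real l / real m) * sin (pi * real k / real m))
          powi (- 2 * int n))"

text \<open>The ring \<open>\<complex>[w][u][v]\<close> is \<open>complex poly poly poly\<close>: \<open>v\<close> is the outermost variable and \<open>w\<close>
  the innermost one, so that \<open>resultant\<close> eliminates first \<open>v\<close> and then \<open>u\<close>.\<close>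

definition W_poly :: "complex poly poly poly" where
  "W_poly =
     (let I = [:[:[:\<i>:]:]:];
          w = [:[:[:0, 1:]:]:];
          u = [:[:0, 1:]:];
          v = [:0, 1:]
      in I * u\<^sup>2 * v\<^sup>2 + u\<^sup>2 * v + u * v\<^sup>2 - 2 * w * u * v + u + v - I)"

definition Q_poly_u :: "nat \<Rightarrow> complex poly poly" where
  "Q_poly_u m = monom 1 m - [:[:\<i> ^ m:]:]"

definition Q_poly_v :: "nat \<Rightarrow> complex poly poly poly" where
  "Q_poly_v m = monom 1 m - [:[:[:\<i> ^ m:]:]:]"

text \<open>\<open>D\<close> is taken in the field \<open>\<complex>(w)\<close>, so that dividing by the power of \<open>w\<close> is a genuine
  division.\<close>

definition D_fract :: "nat \<Rightarrow> complex poly fract" where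
  "D_fract m =
     to_fract (resultant (Q_poly_u m) (resultant (Q_poly_v m) W_poly))
       / to_fract (monom (2 ^ (m\<^sup>2)) (3 * m - 2))"

definition E_poly :: "nat \<Rightarrow> rat poly" where
  "E_poly m = (THE E.
     D_fract m =
       to_fract ((if 3 dvd m then monom 1 2 - [:27 / 4:] else 1) * map_poly of_rat E ^ 3))"

definition E_hat :: "nat \<Rightarrow> rat poly" where
  "E_hat m = (THE F. pcompose F (monom 1 2) = E_poly m)"

text \<open>\<open>reflect_poly p\<close> is \<open>y ^ degree p * p (1 / y)\<close>.\<close>

definition E_vee :: "nat \<Rightarrow> rat poly" where
  "E_vee m = reflect_poly (E_hat m)"

text \<open>The roots are the complex ones; \<open>order\<close> is the multiplicity of a root.\<close>

definition E_vee_power_sum :: "nat \<Rightarrow> nat \<Rightarrow> complex" where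
  "E_vee_power_sum m n =
     (let P = map_poly of_rat (E_vee m) :: complex poly
      in \<Sum>\<alpha> | poly P \<alpha> = 0. of_nat (order \<alpha> P) * \<alpha> ^ n)"

end

theory Submission
  imports Defs
begin

text \<open>Writing the roots of \<open>Q\<close> as \<open>u = \<i> x\<close> and \<open>v = \<i> y\<close> with \<open>x\<^sup>m = y\<^sup>m = 1\<close>, one has
  \<open>W = 2 x y w + \<i> (x - 1) (y - 1) (x y - 1)\<close>, which for \<open>x = exp (2 \<pi> \<i> a / m)\<close> and
  \<open>y = exp (2 \<pi> \<i> b / m)\<close> equals \<open>2 x y (w + 4 s\<^sub>a s\<^sub>b s\<^sub>c)\<close> with \<open>s\<^sub>k = sin (\<pi> k / m)\<close>, \<open>c = a + b\<close>.
  Hence \<open>D\<close> is the product of \<open>w\<^sup>2 - 16 (s\<^sub>a s\<^sub>b s\<^sub>c)\<^sup>2\<close> over the triples of positive integers of sum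
  \<open>m\<close>. Cyclic rotation acts on these triples; its only possible fixed point is \<open>a = b = c = m / 3\<close>,
  with factor \<open>w\<^sup>2 - 27 / 4\<close>, so \<open>E\<close> is the product over the free orbits. The roots of \<open>E_vee\<close> are thus
  the numbers \<open>1 / (4 s\<^sub>a s\<^sub>b s\<^sub>c)\<^sup>2\<close>, one for each orbit, and their power sums give the Verlinde sum.

  For the rationality of \<open>E\<close>: the coefficients of \<open>D\<close> are real and lie in \<open>\<rat>(\<i>)\<close>, being given by
  determinants; the cube root of a rational power series with constant term \<open>1\<close> is rational.\<close>

section \<open>Resultants of split polynomials\<close>

text \<open>Reading each row of the Sylvester matrix as a polynomial, highest power first, turns row
  operations into polynomial identities.\<close>

definition sylvester_row :: "'a::comm_ring_1 poly \<Rightarrow> 'a poly \<Rightarrow> nat \<Rightarrow> 'a poly" where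
  "sylvester_row p q i =
     (if i < degree q then monom 1 (degree q - 1 - i) * p
      else monom 1 (degree p + degree q - 1 - i) * q)"

lemma sylvester_mat_row:
  assumes "i < degree p + degree q" "j < degree p + degree q"
  shows "sylvester_mat p q $$ (i, j) = coeff (sylvester_row p q i) (degree p + degree q - 1 - j)"
  using assms by (subst sylvester_index_mat2)
    (auto simp: sylvester_row_def coeff_monom_mult Suc_diff_Suc not_less intro!: arg_cong[of _ _ "coeff _"])

lemma degree_sylvester_row:
  assumes "i < degree p + degree q"
  shows "degree (sylvester_row p q i) < degree p + degree q"
proof -
  have *: "degree (monom 1 k * r) \<le> k + degree r" for k and r :: "'a poly"
    by (rule order.trans[OF degree_mult_le]) (simp add: degree_monom_le)
  show ?thesis
    using *[of "degree q - 1 - i" p] *[of "degree p + degree q - 1 - i" q] assms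
    by (auto simp: sylvester_row_def)
qed

text \<open>A row of \<open>p\<close> absorbs \<open>X - a\<close> into \<open>p\<close>. For a row
  of \<open>q\<close>, multiplying by \<open>X\<close> gives the row of the same index in the larger
  matrix, and \<open>a\<close> times the original is \<open>a\<close> times the row after
  it.\<close>

lemma sylvester_row_linear_factor_mult:
  fixes p q :: "'a::idom poly"
  assumes p: "p \<noteq> 0" and i: "i < degree p + degree q"
  shows "[:- a, 1:] * sylvester_row p q i =
           sylvester_row ([:- a, 1:] * p) q i
           - (if degree q \<le> i then Polynomial.smult a (sylvester_row ([:- a, 1:] * p) q (Suc i)) else 0)"
proof -
  have deg: "degree ([:- a, 1:] * p) = Suc (degree p)"
    using p by (subst degree_mult_eq) auto
  show ?thesis
  proof (cases "i < degree q")
    case True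
    then show ?thesis unfolding sylvester_row_def deg
      by (simp only: if_True mult.left_commute) simp
  next
    case False
    have "monom 1 (degree p + degree q - i) = pCons 0 (monom (1::'a) (degree p + degree q - Suc i))"
      using i by (simp flip: monom_Suc add: Suc_diff_Suc)
    then show ?thesis using False unfolding sylvester_row_def deg
      by (simp add: algebra_simps)
  qed
qed

text \<open>Evaluates products with the bidiagonal matrix \<open>L\<close> below; the second term
  drops out when \<open>Suc i\<close> leaves the matrix.\<close>

lemma sum_bidiagonal_row:
  fixes t :: "nat \<Rightarrow> 'a::comm_ring_1"
  assumes "i < n"
  shows "(\<Sum>k=0..<n. (if k = i then 1 else if k = Suc i \<and> P then - a else 0) * t k)
       = t i - (if P \<and> Suc i < n then a * t (Suc i) else 0)"
proof -
  have "(\<Sum>k=0..<n. (if k = i then 1 else if k = Suc i \<and> P then - a else 0) * t k)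
      = (\<Sum>k=0..<n. (if k = i then t i else 0) + (if k = Suc i then (if P then - a * t (Suc i) else 0) else 0))"
    by (intro sum.cong) auto
  also have "\<dots> = t i - (if P \<and> Suc i < n then a * t (Suc i) else 0)"
    using assms by (subst sum.distrib) (simp add: sum.delta)
  finally show ?thesis .
qed

lemma sum_bidiagonal_col:
  fixes t :: "nat \<Rightarrow> 'a::comm_ring_1"
  assumes "j < n"
  shows "(\<Sum>k=0..<n. t k * (if j = k then 1 else if j = Suc k then - a else 0))
       = t j - (if j = 0 then 0 else a * t (j - 1))"
proof -
  have "(\<Sum>k=0..<n. t k * (if j = k then 1 else if j = Suc k then - a else 0))
      = (\<Sum>k=0..<n. (if k = j then t j else 0) + (if k = j - 1 then (if j = 0 then 0 else - a * t (j - 1)) else 0))"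
    by (intro sum.cong) auto
  also have "\<dots> = t j - (if j = 0 then 0 else a * t (j - 1))"
    using assms by (subst sum.distrib) (auto simp: sum.delta)
  finally show ?thesis .
qed

text \<open>Division by \<open>X - a\<close>, in the form \<open>f = (X - a) * g + f(a)\<close>, is a unipotent change of basis
  (the matrix \<open>U\<close>). After subtracting \<open>a\<close> times the next row from each row belonging to \<open>q\<close> (the
  matrix \<open>L\<close>), every row polynomial except the last one, \<open>q\<close>, is a multiple of \<open>X - a\<close>, and the
  quotients are the rows of the smaller Sylvester matrix.\<close>

lemma resultant_linear_factor_mult:
  fixes p q :: "'a::idom poly"
  assumes p: "p \<noteq> 0"
  shows "resultant ([:- a, 1:] * p) q = poly q a * resultant p q"
proof -
  define N where "N = degree p + degree q"
  define P where "P = [:- a, 1:] * p"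
  have deg: "degree P = Suc (degree p)"
    using p unfolding P_def by (subst degree_mult_eq) auto
  define L where "L = mat (Suc N) (Suc N)
    (\<lambda>(i, k). if k = i then 1 else if k = Suc i \<and> degree q \<le> i then - a else 0)"
  define U where "U = mat (Suc N) (Suc N)
    (\<lambda>(k, j). if j = k then 1 else if j = Suc k then - a else 0)"
  define S where "S = sylvester_mat P q"
  \<comment> \<open>The blocks are the smaller Sylvester matrix and, in the last row, the quotient
    and remainder of \<open>q\<close> on division by \<open>X - a\<close>.\<close>
  define T where "T = four_block_mat (sylvester_mat p q) (0\<^sub>m N 1)
    (mat 1 N (\<lambda>(i, j). coeff (synthetic_div q a) (N - 1 - j))) (mat 1 1 (\<lambda>_. poly q a))"
  have carrier: "L \<in> carrier_mat (Suc N) (Suc N)" "U \<in> carrier_mat (Suc N) (Suc N)"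
    "S \<in> carrier_mat (Suc N) (Suc N)" "T \<in> carrier_mat (Suc N) (Suc N)"
    unfolding L_def U_def S_def T_def using sylvester_carrier_mat[of P q] sylvester_carrier_mat[of p q]
    by (auto simp: deg N_def)
  have det1: "det L = 1" "det U = 1"
    by (subst det_upper_triangular[of _ "Suc N"];
        force simp: L_def U_def diag_mat_def upper_triangular_def intro!: prod_list_neutral)+
  \<comment> \<open>\<open>g i\<close> and \<open>r i\<close> are the quotient and remainder of the
    \<open>i\<close>-th row of \<open>L * S\<close>.\<close>
  define g where "g i = (if i < N then sylvester_row p q i else synthetic_div q a)" for i
  define r where "r i = (if i < N then 0 else poly q a)" for i
  have T_index: "T $$ (i, j) = (if j < N then coeff (g i) (N - 1 - j) else r i)"
    if "i < Suc N" "j < Suc N" for i j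
    using that unfolding T_def g_def r_def
    by (subst index_mat_four_block) (auto simp: N_def sylvester_mat_row)
  have S_index: "S $$ (i, j) = coeff (sylvester_row P q i) (N - j)"
    if "i < Suc N" "j < Suc N" for i j
    using that unfolding S_def by (subst sylvester_mat_row) (auto simp: deg N_def)
  have g_deg: "coeff (g i) N = 0" if "i < Suc N" "N > 0" for i
    using that degree_sylvester_row[of i p q]
    by (intro coeff_eq_0) (auto simp: g_def degree_synthetic_div N_def)
  have g_eq: "[:- a, 1:] * g i + [:r i:] = sylvester_row P q i
      - (if degree q \<le> i \<and> Suc i < Suc N then Polynomial.smult a (sylvester_row P q (Suc i)) else 0)"
    if i: "i < Suc N" for i
  proof (cases "i < N")
    case True
    then show ?thesis
      using sylvester_row_linear_factor_mult[OF p, of i q a] by (simp add: g_def r_def N_def P_def)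
  next
    case False
    with i have "i = N" by simp
    then have "sylvester_row P q i = q"
      by (auto simp: sylvester_row_def deg N_def)
    then show ?thesis
      using False synthetic_div_correct'[of a q] by (simp add: g_def r_def)
  qed
  have "L * S = T * U"
  proof (rule eq_matI)
    fix i j assume "i < dim_row (T * U)" "j < dim_col (T * U)"
    then have ij: "i < Suc N" "j < Suc N" using carrier by auto
    have "(L * S) $$ (i, j) = (\<Sum>k=0..<Suc N.
        (if k = i then 1 else if k = Suc i \<and> degree q \<le> i then - a else 0) * S $$ (k, j))"
      using ij carrier by (auto simp: scalar_prod_def L_def intro!: sum.cong)
    also have "\<dots> = S $$ (i, j) - (if degree q \<le> i \<and> Suc i < Suc N then a * S $$ (Suc i, j) else 0)"
      using ij(1) by (rule sum_bidiagonal_row)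
    also have "\<dots> = coeff ([:- a, 1:] * g i + [:r i:]) (N - j)"
      unfolding g_eq[OF ij(1)] using ij by (auto simp: S_index)
    also have "\<dots> = T $$ (i, j) - (if j = 0 then 0 else a * T $$ (i, j - 1))"
    proof (cases "j = N")
      case True
      \<comment> \<open>For \<open>N = 0\<close> column \<open>N\<close> is also column
        \<open>0\<close> and has no left neighbour, so \<open>a * coeff (g i) 0\<close> must vanish;
        it does because \<open>q\<close> is constant.\<close>
      have "g i = 0" if "N = 0"
        using that by (simp add: g_def N_def synthetic_div_eq_0_iff)
      with True show ?thesis using ij
        by (cases "N = 0") (auto simp: T_index)
    next
      case False
      then obtain k where N: "N = Suc (j + k)"
        using ij by (metis less_Suc_eq less_imp_Suc_add)
      have "T $$ (i, j) = coeff (g i) k" "N - j = Suc k"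
        using ij by (auto simp: T_index N)
      moreover have "T $$ (i, j - 1) = coeff (g i) (Suc k)" if "j \<noteq> 0"
        using ij that by (auto simp: T_index N)
      moreover have "coeff (g i) (Suc k) = 0" if "j = 0"
        using g_deg[OF ij(1)] that by (simp add: N)
      ultimately show ?thesis
        by (cases "j = 0") simp_all
    qed
    also have "\<dots> = (\<Sum>k=0..<Suc N.
        T $$ (i, k) * (if j = k then 1 else if j = Suc k then - a else 0))"
      using ij(2) by (rule sum_bidiagonal_col[symmetric])
    also have "\<dots> = (T * U) $$ (i, j)"
      using ij carrier by (auto simp: scalar_prod_def U_def intro!: sum.cong)
    finally show "(L * S) $$ (i, j) = (T * U) $$ (i, j)" .
  qed (use carrier in auto)
  then have "det (L * S) = det (T * U)" by simp
  then have "det S = det T"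
    using carrier by (simp add: det_mult[where n = "Suc N"] det1)
  also have "det T = det (sylvester_mat p q) * det (mat 1 1 (\<lambda>_. poly q a))"
    unfolding T_def
    by (rule det_four_block_mat_upper_right_zero_col) (use sylvester_carrier_mat[of p q] in \<open>auto simp: N_def\<close>)
  also have "det (mat 1 1 (\<lambda>_. poly q a)) = poly q a"
    by (subst det_single) auto
  finally show ?thesis
    unfolding resultant_def S_def P_def by (simp add: mult.commute)
qed

lemma resultant_prod_linear_factors:
  fixes q :: "'a::idom poly"
  shows "finite A \<Longrightarrow> resultant (\<Prod>i\<in>A. [:- f i, 1:]) q = (\<Prod>i\<in>A. poly q (f i))"
proof (induction A rule: finite_induct)
  case (insert x A)
  have "(\<Prod>i\<in>A. [:- f i, 1:]) \<noteq> 0"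
    using insert.hyps by auto
  then show ?case
    using insert by (simp add: resultant_linear_factor_mult del: mult_pCons_left)
qed simp

section \<open>Factorization of the double resultant\<close>

text \<open>Two monic polynomials of degree \<open>m\<close> agreeing at \<open>m\<close> distinct
  points are equal. Stated over integral domains because the roots of \<open>Q\<close> are needed as
  constants of polynomial rings.\<close>

lemma monom_minus_const_eq_prod:
  fixes x :: "nat \<Rightarrow> 'a::idom"
  assumes "m > 0" "inj_on x {..<m}" "\<And>k. k < m \<Longrightarrow> x k ^ m = c"
  shows "monom 1 m - [:c:] = (\<Prod>k<m. [:- x k, 1:])"
proof (rule poly_eqI_degree_lead_coeff[where n = m and A = "x ` {..<m}"])
  have deg: "degree (\<Prod>k<m. [:- x k, 1:]) = m"
    by (subst degree_prod_eq_sum_degree) auto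
  have "lead_coeff (\<Prod>k<m. [:- x k, 1:]) = 1"
    by (subst lead_coeff_prod) auto
  then show "coeff (monom 1 m - [:c:]) m = coeff (\<Prod>k<m. [:- x k, 1:]) m"
    using \<open>m > 0\<close> by (simp add: deg coeff_pCons split: nat.splits)
  show "card (x ` {..<m}) \<ge> m"
    using assms(2) by (simp add: card_image)
  show "degree (monom 1 m - [:c:]) \<le> m"
    by (intro degree_diff_le) (auto simp: degree_monom_le)
  show "degree (\<Prod>k<m. [:- x k, 1:]) \<le> m"
    by (simp add: deg)
  fix z assume "z \<in> x ` {..<m}"
  then show "poly (monom 1 m - [:c:]) z = poly (\<Prod>k<m. [:- x k, 1:]) z"
    using assms(3) by (auto simp: poly_monom poly_prod)
qed

definition zeta :: "nat \<Rightarrow> nat \<Rightarrow> complex" where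
  "zeta m k = cis (2 * (pi * real k / real m))"

lemma zeta_power:
  assumes "m > 0"
  shows "zeta m k ^ m = 1"
proof -
  have "zeta m k ^ m = cis (2 * pi * real k)"
    using assms by (simp add: zeta_def DeMoivre mult_ac)
  then show ?thesis
    by (simp add: cis_multiple_2pi)
qed

lemma inj_on_zeta: "m > 0 \<Longrightarrow> inj_on (\<lambda>k. \<i> * zeta m k) {..<m}"
  using bij_betw_roots_unity[of m]
  by (auto simp: bij_betw_def inj_on_def zeta_def mult.assoc)

lemma Q_poly_u_eq_prod:
  assumes "m > 0"
  shows "Q_poly_u m = (\<Prod>k<m. [:- [:\<i> * zeta m k:], 1:])"
  unfolding Q_poly_u_def using assms inj_on_zeta[of m]
  by (intro monom_minus_const_eq_prod)
    (auto simp: inj_on_def poly_const_pow power_mult_distrib zeta_power)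

lemma Q_poly_v_eq_prod:
  assumes "m > 0"
  shows "Q_poly_v m = (\<Prod>k<m. [:- [:[:\<i> * zeta m k:]:], 1:])"
  unfolding Q_poly_v_def using assms inj_on_zeta[of m]
  by (intro monom_minus_const_eq_prod)
    (auto simp: inj_on_def poly_const_pow power_mult_distrib zeta_power)

text \<open>The product formula is applied twice: the inner resultant substitutes the roots for
  \<open>v\<close>, and evaluation in \<open>u\<close> passes through the resulting product.\<close>

lemma resultant_Q_poly:
  assumes "m > 0"
  shows "resultant (Q_poly_u m) (resultant (Q_poly_v m) F) =
    (\<Prod>a<m. \<Prod>b<m. poly (poly F [:[:\<i> * zeta m b:]:]) [:\<i> * zeta m a:])"
  unfolding Q_poly_u_eq_prod[OF assms] Q_poly_v_eq_prod[OF assms]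
    resultant_prod_linear_factors[OF finite_lessThan] poly_prod ..

section \<open>Values of \<open>W_poly\<close> at pairs of roots\<close>

definition sine_product :: "nat \<Rightarrow> nat \<Rightarrow> nat \<Rightarrow> real" where
  "sine_product m a b =
     sin (pi * real a / real m) * sin (pi * real b / real m) * sin (pi * real (a + b) / real m)"

lemma cis_double_minus_one: "cis (2 * t) - 1 = 2 * \<i> * of_real (sin t) * cis t"
  by (rule complex_eqI) (simp_all add: cos_double_sin sin_double power2_eq_square)

lemma poly_W_poly: "poly (poly W_poly [:[:v:]:]) [:u:] =
  [:\<i> * u\<^sup>2 * v\<^sup>2 + u\<^sup>2 * v + u * v\<^sup>2 + u + v - \<i>, - 2 * u * v:]"
  by (simp add: W_poly_def Let_def power2_eq_square algebra_simps numeral_poly)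

lemma poly_W_poly_zeta:
  "poly (poly W_poly [:[:\<i> * zeta m b:]:]) [:\<i> * zeta m a:] =
   Polynomial.smult (2 * zeta m a * zeta m b) [:of_real (4 * sine_product m a b), 1:]"
proof -
  define s t where "s = pi * real a / real m" and "t = pi * real b / real m"
  define x y where "x = zeta m a" and "y = zeta m b"
  have st: "pi * real (a + b) / real m = s + t"
    by (simp add: s_def t_def add_divide_distrib distrib_left)
  have product: "sine_product m a b = sin s * sin t * sin (s + t)"
    unfolding sine_product_def st by (simp add: s_def t_def)
  have xy: "x = cis (2 * s)" "y = cis (2 * t)"
    by (simp_all add: x_def y_def zeta_def s_def t_def)
  have factors: "x - 1 = 2 * \<i> * of_real (sin s) * cis s" "y - 1 = 2 * \<i> * of_real (sin t) * cis t"
    "x * y - 1 = 2 * \<i> * of_real (sin (s + t)) * (cis s * cis t)"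
    using cis_double_minus_one[of s] cis_double_minus_one[of t] cis_double_minus_one[of "s + t"]
    by (simp_all add: xy cis_mult distrib_left)
  have squares: "x = cis s * cis s" "y = cis t * cis t"
    by (simp_all add: xy cis_mult)
  have "\<i> * (\<i> * x)\<^sup>2 * (\<i> * y)\<^sup>2 + (\<i> * x)\<^sup>2 * (\<i> * y) + (\<i> * x) * (\<i> * y)\<^sup>2 + \<i> * x + \<i> * y - \<i>
      = \<i> * ((x - 1) * (y - 1) * (x * y - 1))"
    by (simp add: power2_eq_square algebra_simps)
  \<comment> \<open>The \<open>8\<close> is \<open>\<i> * (2 * \<i>) ^ 3\<close>;
    \<open>cis s\<close> and \<open>cis t\<close> each occur twice and combine to
    \<open>x * y\<close>.\<close>
  also have "\<dots> = 8 * (x * y) * of_real (sin s * sin t * sin (s + t))"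
    unfolding factors unfolding squares by (simp add: mult_ac)
  finally show ?thesis
    unfolding poly_W_poly x_def[symmetric] y_def[symmetric]
    by (simp add: power2_eq_square product)
qed

text \<open>The pair \<open>(a, b)\<close> stands for the triple \<open>(a, b, m - a - b)\<close> of sum \<open>m\<close>. The triples of sum
  \<open>2 * m\<close> are obtained from these by \<open>k \<mapsto> m - k\<close>.\<close>

definition pairs :: "nat \<Rightarrow> (nat \<times> nat) set" where
  "pairs m = {(a, b). 0 < a \<and> 0 < b \<and> a + b < m}"

lemma finite_pairs [simp]: "finite (pairs m)"
  by (rule finite_subset[of _ "{..<m} \<times> {..<m}"]) (auto simp: pairs_def)

text \<open>The lines \<open>a = 0\<close>, \<open>b = 0\<close>, \<open>a + b = m\<close> contain
  \<open>m + (m - 1) + (m - 1)\<close> points of the square, whence the exponent. The remaining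
  points form two triangles exchanged by \<open>(a, b) \<mapsto> (m - a, m - b)\<close>.\<close>

lemma prod_square_split:
  assumes "m > 0"
    and zero: "\<And>a b. a = 0 \<or> b = 0 \<or> a + b = m \<Longrightarrow> f a b = z"
  shows "(\<Prod>a<m. \<Prod>b<m. f a b) =
    z ^ (3 * m - 2) * (\<Prod>(a, b)\<in>pairs m. f a b * f (m - a) (m - b))"
proof -
  define Z where "Z = {0} \<times> {..<m} \<union> {1..<m} \<times> {0} \<union> (\<lambda>a. (a, m - a)) ` {1..<m}"
  define r where "r = (\<lambda>(a, b). (m - a, m - b))"
  have inj: "inj_on r (pairs m)"
    by (auto simp: inj_on_def r_def pairs_def)
  have split: "{..<m} \<times> {..<m} = Z \<union> (pairs m \<union> r ` pairs m)"
  proof (intro equalityI subsetI)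
    fix p assume "p \<in> {..<m} \<times> {..<m}"
    then obtain a b where p: "p = (a, b)" "a < m" "b < m" by auto
    consider "a = 0" | "b = 0" | "a + b = m" "a > 0" "b > 0" | "a > 0" "b > 0" "a + b < m"
      | "a > 0" "b > 0" "a + b > m" by linarith
    then show "p \<in> Z \<union> (pairs m \<union> r ` pairs m)"
    proof cases
      case 3
      then have "p = (a, m - a)" "a \<in> {1..<m}" using p by auto
      then show ?thesis by (auto simp: Z_def)
    next
      case 5
      then have "p = r (m - a, m - b)" "(m - a, m - b) \<in> pairs m"
        using p by (auto simp: r_def pairs_def)
      then show ?thesis by blast
    qed (use p in \<open>auto simp: Z_def pairs_def\<close>)
  qed (use assms in \<open>auto simp: Z_def pairs_def r_def\<close>)
  have fin: "finite Z" by (simp add: Z_def)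
  have disj: "Z \<inter> (pairs m \<union> r ` pairs m) = {}" "pairs m \<inter> r ` pairs m = {}"
    by (auto simp: Z_def pairs_def r_def)
  have "card Z = m + (m - 1) + (m - 1)"
    unfolding Z_def
    by (subst card_Un_disjoint, auto, subst card_Un_disjoint, auto simp: card_image inj_on_def)
  then have card: "card Z = 3 * m - 2" using assms by simp
  have "(\<Prod>a<m. \<Prod>b<m. f a b) = (\<Prod>p\<in>{..<m} \<times> {..<m}. case_prod f p)"
    by (simp add: prod.cartesian_product)
  also have "\<dots> = (\<Prod>p\<in>Z. case_prod f p) *
      ((\<Prod>p\<in>pairs m. case_prod f p) * (\<Prod>p\<in>r ` pairs m. case_prod f p))"
    unfolding split using fin disj by (simp add: prod.union_disjoint)
  also have "(\<Prod>p\<in>Z. case_prod f p) = (\<Prod>p\<in>Z. z)"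
    using zero by (intro prod.cong) (auto simp: Z_def)
  also have "(\<Prod>p\<in>r ` pairs m. case_prod f p) = (\<Prod>(a, b)\<in>pairs m. f (m - a) (m - b))"
    using inj by (subst prod.reindex) (auto simp: r_def intro!: prod.cong)
  finally show ?thesis
    by (simp add: card prod.distrib[symmetric] case_prod_unfold)
qed

text \<open>The square of the root \<open>- 4 * sine_product m a b\<close> in \<open>w\<close>.
  Reflected pairs give opposite roots, so the two linear factors multiply to
  \<open>w\<^sup>2 - weight m (a, b)\<close>.\<close>

definition weight :: "nat \<Rightarrow> nat \<times> nat \<Rightarrow> real" where
  "weight m = (\<lambda>(a, b). 16 * (sine_product m a b)\<^sup>2)"

lemma sine_product_reflect:
  assumes "m > 0" "a \<le> m" "b \<le> m"
  shows "sine_product m (m - a) (m - b) = - sine_product m a b"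
proof -
  have 1: "pi * real (m - k) / real m = pi - pi * real k / real m" if "k \<le> m" for k
    using assms that by (simp add: of_nat_diff field_simps)
  have 2: "pi * real ((m - a) + (m - b)) / real m = 2 * pi - pi * real (a + b) / real m"
    using assms by (simp add: of_nat_diff field_simps)
  show ?thesis
    unfolding sine_product_def 2 1[OF assms(2)] 1[OF assms(3)] by (simp add: sin_diff)
qed

lemma resultant_Q_poly_W_poly:
  assumes "m > 0"
  shows "resultant (Q_poly_u m) (resultant (Q_poly_v m) W_poly) =
    monom (2 ^ m\<^sup>2) (3 * m - 2) * (\<Prod>p\<in>pairs m. [:- of_real (weight m p), 0, 1:])"
proof -
  have zero: "[:of_real (4 * sine_product m a b), 1:] = monom (1::complex) 1"
    if "a = 0 \<or> b = 0 \<or> a + b = m" for a b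
    using that assms by (auto simp: sine_product_def monom_altdef)
  \<comment> \<open>In the double product every root of unity occurs \<open>m\<close> times in each
    variable, so only the powers of \<open>2\<close> survive.\<close>
  have pow1: "(\<Prod>k<m. zeta m k) ^ m = 1"
    using assms by (simp add: prod_power_distrib zeta_power)
  have "(\<Prod>a<m. \<Prod>b<m. 2 * zeta m a * zeta m b) = (\<Prod>a<m. 2 ^ m * (\<Prod>b<m. zeta m b))"
    using assms by (simp add: prod.distrib power_mult_distrib zeta_power)
  also have "\<dots> = 2 ^ m\<^sup>2"
    using pow1 by (simp add: power_mult_distrib power2_eq_square power_mult)
  finally have const: "(\<Prod>a<m. \<Prod>b<m. 2 * zeta m a * zeta m b) = 2 ^ m\<^sup>2" .
  have "resultant (Q_poly_u m) (resultant (Q_poly_v m) W_poly) =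
      Polynomial.smult (2 ^ m\<^sup>2) (\<Prod>a<m. \<Prod>b<m. [:of_real (4 * sine_product m a b), 1:])"
    unfolding resultant_Q_poly[OF assms] poly_W_poly_zeta prod_smult const ..
  also have "(\<Prod>a<m. \<Prod>b<m. [:of_real (4 * sine_product m a b), 1 :: complex:]) =
      monom 1 1 ^ (3 * m - 2) * (\<Prod>(a, b)\<in>pairs m. [:of_real (4 * sine_product m a b), 1:]
        * [:of_real (4 * sine_product m (m - a) (m - b)), 1:])"
    by (rule prod_square_split[where f = "\<lambda>a b. [:of_real (4 * sine_product m a b), 1:]",
          OF assms zero])
  also have "(\<Prod>(a, b)\<in>pairs m. [:of_real (4 * sine_product m a b), 1:]
        * [:of_real (4 * sine_product m (m - a) (m - b)), 1:]) =
      (\<Prod>p\<in>pairs m. [:- of_real (weight m p), 0, 1 :: complex:])"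
    using assms by (intro prod.cong)
      (auto simp: pairs_def weight_def sine_product_reflect power2_eq_square)
  finally show ?thesis
    by (simp add: monom_power smult_monom flip: mult_smult_left)
qed

section \<open>Rotation orbits\<close>

text \<open>Representatives of the free orbits of the rotation \<open>(a, b, c) \<mapsto> (b, c, a)\<close>: the first entry
  is the last minimum in the cyclic order.\<close>

definition orbit_reps :: "nat \<Rightarrow> (nat \<times> nat) set" where
  "orbit_reps m = {(a, b). 0 < a \<and> a < b \<and> 2 * a + b \<le> m}"

lemma orbit_reps_subset: "orbit_reps m \<subseteq> pairs m"
  by (auto simp: orbit_reps_def pairs_def)

lemma finite_orbit_reps [simp]: "finite (orbit_reps m)"
  using orbit_reps_subset finite_pairs by (rule finite_subset)

text \<open>The three rotated copies of the representatives, together with the fixed point if there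
  is one, partition the pairs. The general monoid serves products and sums alike.\<close>

lemma (in comm_monoid_set) pairs_orbits:
  assumes rot: "\<And>a b. (a, b) \<in> pairs m \<Longrightarrow> g (b, m - (a + b)) = g (a, b)"
    and "m > 0"
  shows "F g (pairs m) = F g (orbit_reps m) \<^bold>* F g (orbit_reps m) \<^bold>* F g (orbit_reps m)
    \<^bold>* (if 3 dvd m then g (m div 3, m div 3) else \<^bold>1)"
proof -
  \<comment> \<open>In \<open>R2\<close> and \<open>R3\<close> the last cyclic minimum of
    \<open>(a, b, m - a - b)\<close> is the second and third entry respectively; \<open>R0\<close>
    is the fixed point.\<close>
  define R2 where "R2 = {(a, b). 0 < b \<and> a + b < m \<and> b \<le> a \<and> a + 2 * b < m}"
  define R3 where "R3 = {(a, b). 0 < a \<and> a + b < m \<and> m < 2 * a + b \<and> m \<le> a + 2 * b}"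
  define R0 where "R0 = {(a, b). 0 < a \<and> a = b \<and> 3 * a = m}"
  have split: "pairs m = (orbit_reps m \<union> R2) \<union> (R3 \<union> R0)"
    by (auto simp: pairs_def orbit_reps_def R2_def R3_def R0_def)
  have sub: "R2 \<subseteq> pairs m" "R3 \<subseteq> pairs m" "R0 \<subseteq> pairs m"
    by (auto simp: pairs_def R2_def R3_def R0_def)
  have fin: "finite R2" "finite R3" "finite R0"
    using sub by (auto intro: finite_subset)
  have disj: "(orbit_reps m \<union> R2) \<inter> (R3 \<union> R0) = {}" "orbit_reps m \<inter> R2 = {}" "R3 \<inter> R0 = {}"
    by (auto simp: orbit_reps_def R2_def R3_def R0_def)
  have rot2: "g (m - (a + b), a) = g (a, b)" if "(a, b) \<in> pairs m" for a b
  proof -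
    have "(m - (a + b), a) \<in> pairs m" "m - (m - (a + b) + a) = b"
      using that by (auto simp: pairs_def)
    then show ?thesis
      using rot[of "m - (a + b)" a] by simp
  qed
  have F3: "F g R3 = F g (orbit_reps m)"
    by (rule reindex_bij_witness[of _ "\<lambda>(a, b). (b, m - (a + b))" "\<lambda>(a, b). (m - (a + b), a)"])
      (use rot2 in \<open>auto simp: R3_def orbit_reps_def pairs_def\<close>)
  have F2: "F g R2 = F g (orbit_reps m)"
    by (rule reindex_bij_witness[of _ "\<lambda>(a, b). (m - (a + b), a)" "\<lambda>(a, b). (b, m - (a + b))"])
      (use rot in \<open>auto simp: R2_def orbit_reps_def pairs_def\<close>)
  have "R0 = (if 3 dvd m then {(m div 3, m div 3)} else {})"
    using \<open>m > 0\<close> by (auto simp: R0_def)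
  then have F0: "F g R0 = (if 3 dvd m then g (m div 3, m div 3) else \<^bold>1)"
    by simp
  show ?thesis
    unfolding split using fin disj by (simp add: union_disjoint F0 F2 F3 assoc)
qed

text \<open>As \<open>sin (pi - t) = sin t\<close>, the factor at \<open>a + b\<close> equals the
  factor at the third entry \<open>m - (a + b)\<close>, so the product is symmetric in the
  triple.\<close>

lemma weight_rotate:
  assumes "(a, b) \<in> pairs m"
  shows "weight m (b, m - (a + b)) = weight m (a, b)"
proof -
  have "a + b \<le> m" "a \<le> m" "m > 0"
    using assms by (auto simp: pairs_def)
  then have *: "sin (pi * real (m - (a + b)) / real m) = sin (pi * real (a + b) / real m)"
    "sin (pi * real (b + (m - (a + b))) / real m) = sin (pi * real a / real m)"
    using sin_pi_minus[of "pi * real (a + b) / real m"] sin_pi_minus[of "pi * real a / real m"]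
    by (simp_all add: of_nat_diff diff_divide_distrib right_diff_distrib)
  show ?thesis
    unfolding weight_def sine_product_def prod.case * by (simp only: mult_ac)
qed

lemma weight_center:
  assumes "3 dvd m" "m > 0"
  shows "weight m (m div 3, m div 3) = 27 / 4"
proof -
  obtain k where k: "m = 3 * k" "k > 0"
    using assms by auto
  have "pi * real k / real m = pi / 3" "pi * real (k + k) / real m = 2 * pi / 3"
    using k by (simp_all add: field_simps)
  then have "sine_product m k k = sqrt 3 / 2 * (sqrt 3 / 2) * (sqrt 3 / 2)"
    unfolding sine_product_def by (simp only: sin_60 sin_120)
  then have product: "sine_product m k k = 3 * sqrt 3 / 8"
    by simp
  have third: "m div 3 = k"
    using k by simp
  show ?thesis
    unfolding weight_def third prod.case product by (simp add: power_mult_distrib power_divide)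
qed

lemma weight_pos:
  assumes "p \<in> pairs m"
  shows "weight m p > 0"
proof -
  obtain a b where p: "p = (a, b)" "0 < a" "0 < b" "a + b < m"
    using assms by (auto simp: pairs_def)
  have sin: "sin (pi * real k / real m) > 0" if "0 < k" "k < m" for k
    using that by (intro sin_gt_zero) (auto simp: field_simps)
  have "sine_product m a b > 0"
    unfolding sine_product_def using p by (intro mult_pos_pos sin) auto
  then show ?thesis
    by (simp add: weight_def p)
qed

lemma prod_pairs:
  fixes h :: "real \<Rightarrow> 'a::comm_monoid_mult"
  assumes "m > 0"
  shows "(\<Prod>p\<in>pairs m. h (weight m p)) =
    (if 3 dvd m then h (27 / 4) else 1) * (\<Prod>p\<in>orbit_reps m. h (weight m p)) ^ 3"
  using assms
  by (subst prod.pairs_orbits) (auto simp: weight_rotate weight_center power3_eq_cube mult_ac)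

lemma sum_pairs:
  fixes h :: "real \<Rightarrow> 'a::comm_semiring_1"
  assumes "m > 0"
  shows "(\<Sum>p\<in>pairs m. h (weight m p)) =
    3 * (\<Sum>p\<in>orbit_reps m. h (weight m p)) + (if 3 dvd m then h (27 / 4) else 0)"
proof -
  have three: "(3::'a) = 1 + 1 + 1"
    by simp
  have "3 * x = x + x + x" for x :: 'a
    unfolding three by (simp only: distrib_right mult_1_left)
  then show ?thesis using assms
    by (subst sum.pairs_orbits) (auto simp: weight_rotate weight_center)
qed

section \<open>Rationality\<close>

text \<open>Being a subring passes to polynomials with coefficients in it, so iterating
  \<open>poly_coeffs\<close> covers the nested polynomial rings of both resultants.\<close>

locale closed_subring =
  fixes S :: "'a::comm_ring_1 set"
  assumes one_closed [simp]: "1 \<in> S"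
    and uminus_closed [simp]: "\<And>x. x \<in> S \<Longrightarrow> - x \<in> S"
    and add_closed: "\<And>x y. x \<in> S \<Longrightarrow> y \<in> S \<Longrightarrow> x + y \<in> S"
    and mult_closed: "\<And>x y. x \<in> S \<Longrightarrow> y \<in> S \<Longrightarrow> x * y \<in> S"
begin

lemma zero_closed [simp]: "0 \<in> S"
  using add_closed[OF one_closed uminus_closed[OF one_closed]] by simp

lemma diff_closed: "x \<in> S \<Longrightarrow> y \<in> S \<Longrightarrow> x - y \<in> S"
  using add_closed[of x "- y"] by simp

lemma sum_closed: "(\<And>x. x \<in> A \<Longrightarrow> f x \<in> S) \<Longrightarrow> sum f A \<in> S"
  by (induction A rule: infinite_finite_induct) (auto intro: add_closed)

lemma prod_closed: "(\<And>x. x \<in> A \<Longrightarrow> f x \<in> S) \<Longrightarrow> prod f A \<in> S"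
  by (induction A rule: infinite_finite_induct) (auto intro: mult_closed)

lemma power_closed: "x \<in> S \<Longrightarrow> x ^ n \<in> S"
  by (induction n) (auto intro: mult_closed)

lemma det_closed:
  assumes "\<And>i j. i < dim_row A \<Longrightarrow> j < dim_col A \<Longrightarrow> A $$ (i, j) \<in> S"
  shows "det A \<in> S"
  unfolding det_def
  using assms
  by (auto simp: sign_def permutes_in_image intro!: sum_closed mult_closed[of "_ :: 'a"] prod_closed)

definition poly_coeffs :: "'a poly set" where
  "poly_coeffs = {p. \<forall>i. coeff p i \<in> S}"

lemma resultant_closed:
  assumes "p \<in> poly_coeffs" "q \<in> poly_coeffs"
  shows "resultant p q \<in> S"
  unfolding resultant_def using assms
  by (intro det_closed) (auto simp: sylvester_index_mat poly_coeffs_def)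

lemma closed_subring_poly_coeffs: "closed_subring poly_coeffs"
  by standard
    (auto simp: poly_coeffs_def coeff_pCons one_pCons coeff_mult split: nat.splits
      intro!: add_closed sum_closed mult_closed)

lemma pCons_in_poly_coeffs [simp]: "pCons a p \<in> poly_coeffs \<longleftrightarrow> a \<in> S \<and> p \<in> poly_coeffs"
  by (auto simp: poly_coeffs_def coeff_pCons split: nat.splits)

lemma monom_in_poly_coeffs: "a \<in> S \<Longrightarrow> monom a n \<in> poly_coeffs"
  by (auto simp: poly_coeffs_def)

end

interpretation Rats: closed_subring "\<rat> :: 'a::field_char_0 set"
  by standard auto

interpretation Reals: closed_subring "\<real> :: 'a::{real_algebra_1,comm_ring_1} set"
  by standard auto

text \<open>Splitting \<open>P = Q + X\<^sup>n * B\<close> with \<open>degree Q < n\<close>, the \<open>n\<close>-th coefficient of \<open>A * P\<^sup>3\<close> is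
  \<open>3 * coeff P n\<close> plus that of \<open>A * Q\<^sup>3\<close>, which involves only lower coefficients of \<open>P\<close>.\<close>

lemma coeff_in_Rats_if_cube:
  fixes A P :: "'a::field_char_0 poly"
  assumes AP: "\<And>i. coeff (A * P ^ 3) i \<in> \<rat>" and A: "\<And>i. coeff A i \<in> \<rat>"
    and "coeff A 0 = 1" "coeff P 0 = 1"
  shows "coeff P n \<in> \<rat>"
proof (induction n rule: less_induct)
  case (less n)
  show ?case
  proof (cases "n = 0")
    case False
    define Q B M where "Q = poly_cutoff n P" and "B = poly_shift n P" and "M = monom (1::'a) n"
    have P: "P = Q + M * B"
      by (rule poly_eqI) (auto simp: Q_def B_def M_def coeff_poly_cutoff coeff_poly_shift coeff_monom_mult)
    have "A \<in> Rats.poly_coeffs" "Q \<in> Rats.poly_coeffs"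
      using A less.IH by (auto simp: Rats.poly_coeffs_def Q_def coeff_poly_cutoff)
    then have "A * Q ^ 3 \<in> Rats.poly_coeffs"
      by (intro closed_subring.mult_closed[OF Rats.closed_subring_poly_coeffs]
          closed_subring.power_closed[OF Rats.closed_subring_poly_coeffs])
    then have rat: "coeff (A * Q ^ 3) n \<in> \<rat>"
      by (simp add: Rats.poly_coeffs_def)
    have [simp]: "coeff Q 0 = 1" "coeff M 0 = 0" "coeff B 0 = coeff P n"
      using False assms by (simp_all add: Q_def M_def B_def coeff_poly_cutoff coeff_poly_shift)
    have "A * P ^ 3 = A * Q ^ 3 + M * (A * B * (3 * Q ^ 2 + 3 * Q * M * B + M ^ 2 * B ^ 2))"
      unfolding P by (simp add: power2_eq_square power3_eq_cube algebra_simps)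
    then have "coeff (A * P ^ 3) n =
        coeff (A * Q ^ 3) n + coeff (A * B * (3 * Q ^ 2 + 3 * Q * M * B + M ^ 2 * B ^ 2)) 0"
      by (simp add: M_def coeff_monom_mult)
    also have "coeff (A * B * (3 * Q ^ 2 + 3 * Q * M * B + M ^ 2 * B ^ 2)) 0 = 3 * coeff P n"
      using assms by (simp add: coeff_mult_0 coeff_0_power numeral_poly)
    finally have eq: "coeff P n = (coeff (A * P ^ 3) n - coeff (A * Q ^ 3) n) / 3"
      by simp
    show ?thesis
      unfolding eq using AP rat by (intro Rats_divide Rats_diff) simp_all
  qed (use assms in simp)
qed

section \<open>The coefficients of the double resultant\<close>

lemma W_poly_coeffs:
  "W_poly = [:[:[:- \<i>:], 1:], [:1, [:0, - 2:], 1:], [:0, 1, [:\<i>:]:]:]"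
  by (simp add: W_poly_def Let_def power2_eq_square numeral_poly one_pCons)

definition gaussian_rationals :: "complex set" where
  "gaussian_rationals = {z. Re z \<in> \<rat> \<and> Im z \<in> \<rat>}"

interpretation gaussian: closed_subring gaussian_rationals
  by standard (auto simp: gaussian_rationals_def)

interpretation gaussian1: closed_subring gaussian.poly_coeffs
  by (rule gaussian.closed_subring_poly_coeffs)

interpretation gaussian2: closed_subring gaussian1.poly_coeffs
  by (rule gaussian1.closed_subring_poly_coeffs)

text \<open>A resultant is a determinant in the coefficients, and those of \<open>W_poly\<close> and
  both \<open>Q\<close> are Gaussian rationals.\<close>

lemma resultant_Q_poly_W_poly_gaussian:
  "resultant (Q_poly_u m) (resultant (Q_poly_v m) W_poly) \<in> gaussian.poly_coeffs"
proof -
  have [simp]: "\<i> \<in> gaussian_rationals" "2 \<in> gaussian_rationals"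
    by (auto simp: gaussian_rationals_def)
  have [simp]: "\<i> ^ m \<in> gaussian_rationals"
    by (rule gaussian.power_closed) simp
  have "Q_poly_u m \<in> gaussian1.poly_coeffs"
    unfolding Q_poly_u_def by (intro gaussian2.diff_closed gaussian1.monom_in_poly_coeffs) simp_all
  moreover have "Q_poly_v m \<in> gaussian2.poly_coeffs"
    unfolding Q_poly_v_def
    by (intro closed_subring.diff_closed[OF gaussian2.closed_subring_poly_coeffs]
        gaussian2.monom_in_poly_coeffs) (simp_all add: closed_subring.zero_closed[OF gaussian2.closed_subring_poly_coeffs])
  moreover have "W_poly \<in> gaussian2.poly_coeffs"
    unfolding W_poly_coeffs
    by (simp add: closed_subring.zero_closed[OF gaussian2.closed_subring_poly_coeffs])
  ultimately show ?thesis
    by (intro gaussian1.resultant_closed gaussian2.resultant_closed)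
qed

lemma of_real_in_gaussian_imp_Rats:
  assumes "of_real x \<in> gaussian_rationals"
  shows "complex_of_real x \<in> \<rat>"
proof -
  have "x \<in> \<rat>"
    using assms by (simp add: gaussian_rationals_def)
  then obtain i and n :: nat where "x = of_int i / of_nat n"
    by (auto simp: Rats_eq_int_div_nat)
  then show ?thesis
    by simp
qed

text \<open>Written in \<open>x = w\<^sup>2\<close>: over \<open>pairs m\<close> it represents
  \<open>D\<close>, over \<open>orbit_reps m\<close> it will be \<open>E_hat\<close>.\<close>

definition weight_poly :: "(nat \<times> nat) set \<Rightarrow> nat \<Rightarrow> complex poly" where
  "weight_poly A m = (\<Prod>p\<in>A. [:- of_real (weight m p), 1:])"

lemma pcompose_weight_poly:
  "pcompose (weight_poly A m) (monom 1 2) = (\<Prod>p\<in>A. [:- of_real (weight m p), 0, 1:])"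
  by (simp add: weight_poly_def pcompose_prod pcompose_pCons monom_altdef power2_eq_square)

lemma reflect_weight_poly:
  "reflect_poly (weight_poly A m) = (\<Prod>p\<in>A. [:1, - of_real (weight m p):])"
  unfolding weight_poly_def reflect_poly_prod
  by (intro prod.cong) (auto simp: reflect_poly_def)

lemma coeff_weight_poly_pairs_in_Rats:
  assumes "m > 0"
  shows "coeff (weight_poly (pairs m) m) k \<in> \<rat>"
proof -
  define c where "c = coeff (weight_poly (pairs m) m) k"
  have "c \<in> \<real>"
    using closed_subring.prod_closed[OF Reals.closed_subring_poly_coeffs, of "pairs m"
        "\<lambda>p. [:- complex_of_real (weight m p), 1:]"]
    by (auto simp: c_def weight_poly_def Reals.poly_coeffs_def coeff_pCons split: nat.splits)
  then obtain r where r: "c = of_real r"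
    by (auto elim: Reals_cases)
  \<comment> \<open>The monomial factor shifts indices by \<open>3 * m - 2\<close>, and substituting
    \<open>w\<^sup>2\<close> moves the \<open>k\<close>-th coefficient to position
    \<open>2 * k\<close>.\<close>
  have "coeff (resultant (Q_poly_u m) (resultant (Q_poly_v m) W_poly)) (3 * m - 2 + 2 * k)
      = 2 ^ m\<^sup>2 * c"
    using coeff_pcompose_monom[of 0 2 "weight_poly (pairs m) m" k]
    by (simp add: resultant_Q_poly_W_poly[OF assms] pcompose_weight_poly[symmetric]
        coeff_monom_mult c_def)
  also have "\<dots> = of_real (2 ^ m\<^sup>2 * r)"
    by (simp add: r)
  finally have "of_real (2 ^ m\<^sup>2 * r) \<in> gaussian_rationals"
    using resultant_Q_poly_W_poly_gaussian[of m]
    unfolding gaussian.poly_coeffs_def mem_Collect_eq by metis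
  then have "complex_of_real (2 ^ m\<^sup>2 * r) \<in> \<rat>"
    by (rule of_real_in_gaussian_imp_Rats)
  then have "complex_of_real (2 ^ m\<^sup>2 * r) / 2 ^ m\<^sup>2 \<in> \<rat>"
    by (intro Rats_divide Rats_power) auto
  then show ?thesis
    by (simp add: r flip: c_def)
qed

lemma coeff_reflect_poly_in_Rats:
  "(\<And>i. coeff p i \<in> \<rat>) \<Longrightarrow> coeff (reflect_poly p) i \<in> \<rat>"
  by (simp add: coeff_reflect_poly)

text \<open>Reversal turns monic polynomials into ones with constant term \<open>1\<close>, as the
  cube root argument requires; it can be undone because all weights are nonzero.\<close>

lemma coeff_weight_poly_orbit_reps_in_Rats:
  assumes "m > 0"
  shows "coeff (weight_poly (orbit_reps m) m) k \<in> \<rat>"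
proof -
  define P where "P = reflect_poly (weight_poly (orbit_reps m) m)"
  define A :: "complex poly" where "A = (if 3 dvd m then [:1, - (27 / 4):] else 1)"
  have "reflect_poly (weight_poly (pairs m) m) = A * P ^ 3"
    unfolding reflect_weight_poly P_def A_def
    using prod_pairs[OF assms, where h = "\<lambda>x. [:1, - complex_of_real x:]"] by simp
  then have AP: "coeff (A * P ^ 3) i \<in> \<rat>" for i
    using coeff_reflect_poly_in_Rats[OF coeff_weight_poly_pairs_in_Rats[OF assms], of i] by simp
  have "coeff P 0 = 1"
    unfolding P_def weight_poly_def by (simp add: lead_coeff_prod)
  moreover have "coeff A 0 = 1" "\<And>i. coeff A i \<in> \<rat>"
    by (auto simp: A_def coeff_pCons split: nat.splits)
  ultimately have "coeff P i \<in> \<rat>" for i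
    using AP by (intro coeff_in_Rats_if_cube[of A P]) auto
  moreover have "reflect_poly P = weight_poly (orbit_reps m) m"
    unfolding P_def
  proof (rule reflect_poly_reflect_poly)
    have "weight m p \<noteq> 0" if "p \<in> orbit_reps m" for p
      using weight_pos[OF subsetD[OF orbit_reps_subset that]] by simp
    then show "coeff (weight_poly (orbit_reps m) m) 0 \<noteq> 0"
      by (simp add: weight_poly_def poly_prod flip: poly_0_coeff_0)
  qed
  ultimately show ?thesis
    using coeff_reflect_poly_in_Rats[of P k] by simp
qed

section \<open>Identification of \<open>E\<close> and its reversal\<close>

lemma D_fract_eq:
  assumes "m > 0"
  shows "D_fract m = to_fract ((if 3 dvd m then monom 1 2 - [:27 / 4:] else 1)
    * pcompose (weight_poly (orbit_reps m) m) (monom 1 2) ^ 3)"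
proof -
  have "monom 1 2 - [:27 / 4:] = [:- complex_of_real (27 / 4), 0, 1:]"
    by (simp add: monom_altdef power2_eq_square)
  then show ?thesis
    unfolding D_fract_def resultant_Q_poly_W_poly[OF assms] pcompose_weight_poly
    using prod_pairs[OF assms, where h = "\<lambda>x. [:- complex_of_real x, 0, 1:]"] by simp
qed

text \<open>The cofactor of \<open>a - b\<close> is a sum of squares. Applied to the ordered ring of
  rational polynomials; over the complex numbers cube roots of unity would spoil uniqueness.\<close>

lemma cube_inject:
  fixes a b :: "'a::linordered_idom"
  assumes "a ^ 3 = b ^ 3"
  shows "a = b"
proof -
  have "(a - b) * (a\<^sup>2 + b\<^sup>2 + (a + b)\<^sup>2) = 2 * (a ^ 3 - b ^ 3)"
    by (simp add: power2_eq_square power3_eq_cube algebra_simps)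
  then have "a - b = 0 \<or> a\<^sup>2 + b\<^sup>2 + (a + b)\<^sup>2 = 0"
    using assms by simp
  then show ?thesis
    by (auto simp: add_nonneg_eq_0_iff)
qed

interpretation of_rat_poly: map_poly_inj_idom_hom "of_rat :: rat \<Rightarrow> complex" ..

text \<open>Both definite descriptions are resolved: cancelling the nonzero prefactor leaves an
  equation of rational cubes, and substituting \<open>w\<^sup>2\<close> is injective.\<close>

lemma E_hat_eq:
  assumes "m > 0" and F: "weight_poly (orbit_reps m) m = map_poly of_rat F"
  shows "E_hat m = F"
proof -
  define A :: "complex poly" where "A = (if 3 dvd m then monom 1 2 - [:27 / 4:] else 1)"
  have "coeff A (if 3 dvd m then 2 else 0) \<noteq> 0"
    by (auto simp: A_def coeff_pCons split: nat.splits)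
  then have A: "A \<noteq> 0"
    by auto
  have D: "D_fract m = to_fract (A * map_poly of_rat (pcompose F (monom 1 2)) ^ 3)"
    unfolding D_fract_eq[OF assms(1)] F A_def
    by (simp add: of_rat_hom.map_poly_pcompose map_poly_monom)
  have "E_poly m = pcompose F (monom 1 2)"
    unfolding E_poly_def A_def[symmetric]
  proof (rule the_equality)
    fix E :: "rat poly"
    assume "D_fract m = to_fract (A * map_poly of_rat E ^ 3)"
    then have "map_poly of_rat E ^ 3 = (map_poly of_rat (pcompose F (monom 1 2)) ^ 3 :: complex poly)"
      using A by (simp add: D del: to_fract_mult)
    then have "E ^ 3 = pcompose F (monom 1 2) ^ 3"
      by (simp flip: of_rat_poly.hom_power)
    then show "E = pcompose F (monom 1 2)"
      by (rule cube_inject)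
  qed (fact D)
  then show ?thesis
    unfolding E_hat_def
  proof (intro the_equality)
    fix G assume "pcompose G (monom 1 2) = E_poly m"
    then have "pcompose (G - F) (monom 1 2) = 0"
      using \<open>E_poly m = _\<close> by (simp add: pcompose_diff)
    then show "G = F"
      by (simp add: pcompose_eq_0_iff degree_monom_eq)
  qed simp
qed

lemma map_poly_E_vee:
  assumes "m > 0"
  shows "map_poly of_rat (E_vee m) = (\<Prod>p\<in>orbit_reps m. [:1, - complex_of_real (weight m p):])"
proof -
  obtain F where F: "weight_poly (orbit_reps m) m = map_poly of_rat F"
    using coeff_weight_poly_orbit_reps_in_Rats[OF assms] by (rule ratpolyE)
  have "map_poly of_rat (reflect_poly F) = reflect_poly (map_poly of_rat F :: complex poly)"
    by (rule poly_eqI) (simp add: coeff_reflect_poly coeff_map_poly degree_map_poly)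
  then show ?thesis
    unfolding E_vee_def E_hat_eq[OF assms F] F[symmetric] reflect_weight_poly .
qed

section \<open>Power sums\<close>

text \<open>Each factor contributes the one root \<open>1 / c i\<close>; the multiplicity of a root
  counts the indices sharing it, so exchanging the sums gives one term per index.\<close>

lemma sum_roots_reflected_linear_factors:
  fixes c :: "'i \<Rightarrow> 'a::field"
  assumes "finite A" "\<And>i. i \<in> A \<Longrightarrow> c i \<noteq> 0"
  defines "P \<equiv> \<Prod>i\<in>A. [:1, - c i:]"
  shows "(\<Sum>\<alpha> | poly P \<alpha> = 0. of_nat (order \<alpha> P) * \<alpha> ^ n) = (\<Sum>i\<in>A. (1 / c i) ^ n)"
proof -
  have P: "P \<noteq> 0"
    using assms(1) by (simp add: P_def)
  have factor: "proots [:1, - c i:] = {#1 / c i#}" if "i \<in> A" for i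
  proof -
    have "[:1, - c i:] = Polynomial.smult (- c i) [:- (1 / c i), 1:]"
      using assms(2)[OF that] by simp
    then show ?thesis
      using assms(2)[OF that] by (simp only: proots_smult neg_equal_0_iff_equal not_False_eq_True
          proots_linear_factor minus_minus)
  qed
  have "proots P = (\<Sum>i\<in>A. {#1 / c i#})"
    unfolding P_def by (subst proots_prod) (auto simp: factor)
  then have "order \<alpha> P = (\<Sum>i\<in>A. if 1 / c i = \<alpha> then 1 else 0)" for \<alpha>
    using count_proots[OF P, of \<alpha>] by (simp add: count_sum cong: if_cong)
  then have "(\<Sum>\<alpha> | poly P \<alpha> = 0. of_nat (order \<alpha> P) * \<alpha> ^ n)
      = (\<Sum>\<alpha> | poly P \<alpha> = 0. \<Sum>i\<in>A. if 1 / c i = \<alpha> then \<alpha> ^ n else 0)"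
    by (auto simp: sum_distrib_right intro!: sum.cong)
  also have "\<dots> = (\<Sum>i\<in>A. \<Sum>\<alpha> | poly P \<alpha> = 0. if 1 / c i = \<alpha> then \<alpha> ^ n else 0)"
    by (rule sum.swap)
  also have "\<dots> = (\<Sum>i\<in>A. (1 / c i) ^ n)"
  proof (intro sum.cong refl)
    fix i assume i: "i \<in> A"
    then have "poly P (1 / c i) = 0"
      using assms(1,2) by (auto simp: P_def poly_prod)
    then show "(\<Sum>\<alpha> | poly P \<alpha> = 0. if 1 / c i = \<alpha> then \<alpha> ^ n else 0) = (1 / c i) ^ n"
      using poly_roots_finite[OF P] by (simp add: sum.delta')
  qed
  finally show ?thesis .
qed

lemma E_vee_power_sum_eq:
  assumes "m > 0"
  shows "E_vee_power_sum m n = of_real (\<Sum>p\<in>orbit_reps m. (1 / weight m p) ^ n)"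
proof -
  have "weight m p \<noteq> 0" if "p \<in> orbit_reps m" for p
    using weight_pos[OF subsetD[OF orbit_reps_subset that]] by simp
  then show ?thesis
    unfolding E_vee_power_sum_def Let_def map_poly_E_vee[OF assms]
    by (subst sum_roots_reflected_linear_factors) auto
qed

text \<open>The entries lie strictly between \<open>0\<close> and \<open>m\<close>, so their sum is
  \<open>m\<close> or \<open>2 * m\<close>; \<open>\<phi>\<close> and \<open>\<psi>\<close>
  parametrize these two cases by pairs, with equal summands.\<close>

lemma verlinde_sum_eq_sum_pairs:
  assumes "m > 0"
  shows "verlinde_sum n m =
    3 ^ n * real m ^ (2 * n) * (2 * (\<Sum>p\<in>pairs m. (1 / (4 * weight m p)) ^ n))"
proof -
  define T where "T = {(j, l, k). j \<in> {1..<m} \<and> l \<in> {1..<m} \<and> k \<in> {1..<m} \<and> m dvd j + l + k}"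
  define g where "g = (\<lambda>(j, l, k). (8 * sin (pi * real j / real m) * sin (pi * real l / real m)
    * sin (pi * real k / real m)) powi (- 2 * int n))"
  define \<phi> \<psi> where "\<phi> = (\<lambda>(a, b). (a, b, m - (a + b)))" and "\<psi> = (\<lambda>(a, b). (m - a, m - b, a + b))"
  have T: "T = \<phi> ` pairs m \<union> \<psi> ` pairs m"
  proof (intro equalityI subsetI)
    fix t assume "t \<in> T"
    then obtain j l k where t: "t = (j, l, k)" "j \<in> {1..<m}" "l \<in> {1..<m}" "k \<in> {1..<m}"
      "m dvd j + l + k"
      by (auto simp: T_def)
    obtain q where q: "j + l + k = m * q"
      using t by (auto elim: dvdE)
    have "m * q < m * 3"
      unfolding q[symmetric] using t by auto
    then have "q < 3" by simp
    moreover have "q \<noteq> 0"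
      by (rule notI) (use q t in auto)
    ultimately consider "q = 1" | "q = 2" by linarith
    then show "t \<in> \<phi> ` pairs m \<union> \<psi> ` pairs m"
    proof cases
      case 1
      then have "t = \<phi> (j, l)" "(j, l) \<in> pairs m"
        using t q by (auto simp: \<phi>_def pairs_def)
      then show ?thesis by blast
    next
      case 2
      then have "t = \<psi> (m - j, m - l)" "(m - j, m - l) \<in> pairs m"
        using t q by (auto simp: \<psi>_def pairs_def)
      then show ?thesis by blast
    qed
  next
    fix t assume "t \<in> \<phi> ` pairs m \<union> \<psi> ` pairs m"
    then show "t \<in> T"
    proof
      assume "t \<in> \<psi> ` pairs m"
      then obtain a b where ab: "t = \<psi> (a, b)" "(a, b) \<in> pairs m" by auto
      then have "(m - a) + (m - b) + (a + b) = m * 2"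
        by (auto simp: pairs_def)
      then have "m dvd (m - a) + (m - b) + (a + b)" by simp
      then show ?thesis
        using ab by (auto simp: \<psi>_def T_def pairs_def)
    qed (auto simp: \<phi>_def T_def pairs_def)
  qed
  have disj: "\<phi> ` pairs m \<inter> \<psi> ` pairs m = {}"
    by (auto simp: \<phi>_def \<psi>_def pairs_def)
  have inj: "inj_on \<phi> (pairs m)" "inj_on \<psi> (pairs m)"
    by (auto simp: inj_on_def \<phi>_def \<psi>_def pairs_def)
  have reflect: "sin (pi * real (m - k) / real m) = sin (pi * real k / real m)" if "k \<le> m" for k
    using assms that sin_pi_minus[of "pi * real k / real m"]
    by (simp add: of_nat_diff diff_divide_distrib right_diff_distrib)
  \<comment> \<open>\<open>8\<^sup>2 = 4 * 16\<close> relates the squared Verlinde factor to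
    \<open>weight\<close>.\<close>
  have power: "(8 * sine_product m a b) powi (- 2 * int n) = (1 / (4 * weight m (a, b))) ^ n" for a b
  proof -
    have "- 2 * int n = - int (2 * n)" by simp
    then show ?thesis
      by (simp only: power_int_minus power_int_of_nat power_mult)
        (simp add: weight_def power_mult_distrib power_one_over inverse_eq_divide power_divide)
  qed
  have g: "g (\<phi> p) = (1 / (4 * weight m p)) ^ n" "g (\<psi> p) = (1 / (4 * weight m p)) ^ n"
    if "p \<in> pairs m" for p
    using that power[of "fst p" "snd p"]
    by (auto simp: g_def \<phi>_def \<psi>_def pairs_def sine_product_def reflect mult.assoc
        simp del: of_nat_add of_nat_diff)
  have "(\<Sum>t\<in>T. g t) = (\<Sum>p\<in>pairs m. g (\<phi> p)) + (\<Sum>p\<in>pairs m. g (\<psi> p))"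
    unfolding T using disj inj by (simp add: sum.union_disjoint sum.reindex)
  also have "\<dots> = 2 * (\<Sum>p\<in>pairs m. (1 / (4 * weight m p)) ^ n)"
    by (simp add: g)
  finally show ?thesis
    unfolding verlinde_sum_def T_def g_def by simp
qed

theorem mainTheorem5:
  fixes m n :: nat
  assumes "m \<ge> 3" and "n \<ge> 1"
  shows "complex_of_real (verlinde_sum n m) =
           of_bool (3 dvd m) * (2 * (of_nat m / 3) ^ (2 * n))
           + 6 * 3 ^ n * (of_nat m / 2) ^ (2 * n) * E_vee_power_sum m n"
proof -
  have m: "m > 0"
    using assms by simp
  define s where "s = (\<Sum>p\<in>orbit_reps m. (1 / weight m p) ^ n)"
  have s: "(\<Sum>p\<in>orbit_reps m. (1 / (4 * weight m p)) ^ n) = s / 4 ^ n"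
    by (simp add: s_def sum_divide_distrib power_divide power_mult_distrib mult.commute)
  \<comment> \<open>The fixed point has weight \<open>27 / 4\<close>, so it contributes
    \<open>1 / (4 * (27 / 4)) = 1 / 27\<close>.\<close>
  have "verlinde_sum n m =
      3 ^ n * real m ^ (2 * n) * (2 * (3 * (s / 4 ^ n) + of_bool (3 dvd m) * (1 / 27) ^ n))"
    unfolding verlinde_sum_eq_sum_pairs[OF m]
      sum_pairs[OF m, where h = "\<lambda>x. (1 / (4 * x)) ^ n"] s by simp
  also have "\<dots> = of_bool (3 dvd m) * (2 * (real m / 3) ^ (2 * n))
      + 6 * 3 ^ n * (real m / 2) ^ (2 * n) * s"
  proof -
    have "(real m / 3) ^ (2 * n) = real m ^ (2 * n) / 9 ^ n"
      "(real m / 2) ^ (2 * n) = real m ^ (2 * n) / 4 ^ n"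
      by (simp_all add: power_mult power_divide)
    \<comment> \<open>Splitting \<open>27 = 3 * 9\<close> cancels the prefactor \<open>3 ^ n\<close>
      and leaves the power of \<open>m / 3\<close>.\<close>
    moreover have "(1 / 27 :: real) ^ n = 1 / (3 ^ n * 9 ^ n)"
      by (simp add: power_one_over flip: power_mult_distrib)
    ultimately show ?thesis
      by (simp add: algebra_simps)
  qed
  finally show ?thesis
    by (simp add: E_vee_power_sum_eq[OF m] s_def)
qed

end
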